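(* Let $n,s,t$ be positive integers with $2\leq s\leq t<n$. Every edge-colored graph $G$ of order $n$ that contains no properly colored $K_{s,t}$ contains a spanning subgraph $H$ (with the inherited coloring) which admits an orientation $D$ such that: (i) for each $v\in V(G)$, $d^+_D(v)> d^c_G(v)-\left(\frac{t-1}{(s-1)!}\right)^{1/s}s\,n^{1-1/s}-s$; (ii) every directed cycle in $D$ is a properly colored cycle in $H$.
   Context: All graphs are finite and simple. An edge-colored graph is a graph with a color assigned to each edge (not necessarily proper). The color degree $d^c_G(v)$ is the number of distinct colors on edges of $G$ incident to $v$. A subgraph is properly colored if any two adjacent edges of it receive different colors. An orientation $D$ of $H$ assigns a direction to every edge of $H$; $d^+_D(v)$ is the out-degree of $v$ in $D$. *)

theory Defs
  imports Complex_Main "Graph_Theory.Graph_Theory"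
begin

text \<open>
  A finite simple graph is a \<^const>\<open>pair_graph\<close>, i.e. a finite, loop-free, symmetric set of
  ordered pairs. An edge colouring is a function \<open>col\<close> on unordered pairs \<open>{u, v}\<close>. Only its values
  on edges matter, and a subgraph inherits its colouring by using the same function.
\<close>

definition edges_of :: "'a rel \<Rightarrow> 'a set set" where
  "edges_of R = (\<lambda>(u, v). {u, v}) ` R"

definition colour_degree :: "'a pair_pre_digraph \<Rightarrow> ('a set \<Rightarrow> 'c) \<Rightarrow> 'a \<Rightarrow> nat" where
  "colour_degree G col v = card {col {v, w} | w. (v, w) \<in> parcs G}"

definition properly_coloured :: "'a set set \<Rightarrow> ('a set \<Rightarrow> 'c) \<Rightarrow> bool" where
  "properly_coloured E col \<longleftrightarrow>
     (\<forall>e\<in>E. \<forall>f\<in>E. e \<noteq> f \<and> e \<inter> f \<noteq> {} \<longrightarrow> col e \<noteq> col f)"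

definition has_properly_coloured_complete_bipartite ::
  "nat \<Rightarrow> nat \<Rightarrow> 'a pair_pre_digraph \<Rightarrow> ('a set \<Rightarrow> 'c) \<Rightarrow> bool" where
  "has_properly_coloured_complete_bipartite s t G col \<longleftrightarrow>
     (\<exists>K :: 'a pair_pre_digraph. subgraph (with_proj K) (with_proj G) \<and>
        complete_bipartite_digraph s t (with_proj K) \<and>
        properly_coloured (edges_of (parcs K)) col)"

definition orientation_of :: "'a pair_pre_digraph \<Rightarrow> 'a pair_pre_digraph \<Rightarrow> bool" where
  "orientation_of D H \<longleftrightarrow>
     pverts D = pverts H \<and> parcs D \<union> (parcs D)\<inverse> = parcs H \<and> parcs D \<inter> (parcs D)\<inverse> = {}"

text \<open>
  The library's \<open>cycle\<close> counts a single edge traversed back and forth in a symmetric digraph as a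
  cycle; the length bound excludes this for the undirected graph \<open>H\<close>.
\<close>

definition properly_coloured_cycle ::
  "'a pair_pre_digraph \<Rightarrow> ('a set \<Rightarrow> 'c) \<Rightarrow> ('a \<times> 'a) list \<Rightarrow> bool" where
  "properly_coloured_cycle H col p \<longleftrightarrow>
     pre_digraph.cycle (with_proj H) p \<and> 3 \<le> length p \<and>
     properly_coloured (edges_of (set p)) col"

end

theory Submission
  imports Defs
begin

text \<open>
  Pass to a minimal set of edges showing the same colours at every vertex; its colour classes are
  disjoint unions of stars. If every star is oriented either entirely towards its centre or entirely
  away from it, no directed path of length two is monochromatic, so every directed cycle is properly
  coloured. A star oriented inwards costs its centre one colour, and a star oriented outwards costs
  each of its leaves one colour; it remains to choose the orientations so that no vertex loses much.

  By linear programming duality a fractional choice exists as soon as, for all positive weights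
  \<open>\<omega>\<close> on the vertices, the cheapest choice has weighted loss at most \<open>d \<cdot> \<Sum>\<omega>\<close>. That cost is a
  fractional packing of the edges in which every colour class at \<open>x\<close> has weight at most \<open>\<omega> x\<close>, and
  a weighted version of the Kovari--Sos--Turan double count bounds it. The duality is made
  effective by the multiplicative weights algorithm: it yields a sequence of orientations whose average
  loss is at most \<open>d + \<epsilon>\<close> everywhere, and giving each star its majority orientation at most
  doubles the loss.
\<close>

section \<open>Sums over rainbow lists\<close>

lemma sum_rel_eq_sum_Image:
  fixes f :: "'a \<Rightarrow> 'b \<Rightarrow> 'c::comm_monoid_add"
  assumes "finite A" and "finite B" and "R \<subseteq> A \<times> B"
  shows "(\<Sum>(u, v)\<in>R. f u v) = (\<Sum>u\<in>A. \<Sum>v\<in>R `` {u}. f u v)"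
proof -
  have "(SIGMA u:A. R `` {u}) = R" using assms(3) by auto
  moreover have "\<forall>u\<in>A. finite (R `` {u})"
    using assms by (auto intro: finite_subset[of _ B])
  ultimately show ?thesis
    using sum.Sigma[OF assms(1), of "\<lambda>u. R `` {u}" f] by simp
qed

text \<open>Ordered tuples instead of sets: extending by one entry is then a plain product step, and
  no factor \<open>k!\<close> has to be carried.\<close>

definition rainbow_lists :: "'a set \<Rightarrow> ('a \<Rightarrow> 'c) \<Rightarrow> nat \<Rightarrow> 'a list set" where
  "rainbow_lists N \<kappa> k = {xs. length xs = k \<and> set xs \<subseteq> N \<and> distinct (map \<kappa> xs)}"

lemma finite_rainbow_lists: "finite N \<Longrightarrow> finite (rainbow_lists N \<kappa> k)"
  by (rule finite_subset[OF _ finite_lists_length_eq[of N k]]) (auto simp: rainbow_lists_def)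

lemma rainbow_lists_0: "rainbow_lists N \<kappa> 0 = {[]}"
  by (auto simp: rainbow_lists_def)

lemma rainbow_lists_Suc:
  "rainbow_lists N \<kappa> (Suc k) =
     (\<lambda>(xs, x). x # xs) ` (SIGMA xs:rainbow_lists N \<kappa> k. {x \<in> N. \<kappa> x \<notin> \<kappa> ` set xs})"
proof (intro set_eqI iffI)
  fix ys assume "ys \<in> rainbow_lists N \<kappa> (Suc k)"
  then show "ys \<in> (\<lambda>(xs, x). x # xs) ` (SIGMA xs:rainbow_lists N \<kappa> k. {x \<in> N. \<kappa> x \<notin> \<kappa> ` set xs})"
    by (cases ys) (auto simp: rainbow_lists_def image_iff)
qed (auto simp: rainbow_lists_def)

lemma rainbow_lists_sum_Suc:
  fixes p :: "'a \<Rightarrow> real"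
  assumes "finite N"
  shows "(\<Sum>xs\<in>rainbow_lists N \<kappa> (Suc k). prod_list (map p xs)) =
    (\<Sum>xs\<in>rainbow_lists N \<kappa> k. prod_list (map p xs) * sum p {x \<in> N. \<kappa> x \<notin> \<kappa> ` set xs})"
proof -
  have "(\<Sum>xs\<in>rainbow_lists N \<kappa> (Suc k). prod_list (map p xs)) =
     (\<Sum>(xs, x)\<in>(SIGMA xs:rainbow_lists N \<kappa> k. {x \<in> N. \<kappa> x \<notin> \<kappa> ` set xs}).
        p x * prod_list (map p xs))"
    unfolding rainbow_lists_Suc
    by (subst sum.reindex) (auto simp: inj_on_def case_prod_unfold)
  also have "\<dots> = (\<Sum>xs\<in>rainbow_lists N \<kappa> k. \<Sum>x\<in>{x \<in> N. \<kappa> x \<notin> \<kappa> ` set xs}.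
        p x * prod_list (map p xs))"
    using assms by (subst sum.Sigma) (auto simp: finite_rainbow_lists)
  finally show ?thesis by (simp add: sum_distrib_left mult.commute)
qed

text \<open>Build the list entry by entry: fewer than \<open>s\<close> colours are already used and
  each weighs at most 1, so the admissible next entries weigh at least
  \<open>sum p N - (s - 1)\<close>. Truncation at 0 keeps the base of the power nonnegative.\<close>

lemma rainbow_lists_sum_ge:
  fixes p :: "'a \<Rightarrow> real"
  assumes N: "finite N" and nonneg: "\<And>x. x \<in> N \<Longrightarrow> 0 \<le> p x"
    and colour: "\<And>c. sum p {x \<in> N. \<kappa> x = c} \<le> 1" and "k \<le> s"
  shows "(max 0 (sum p N - (real s - 1))) ^ k \<le> (\<Sum>xs\<in>rainbow_lists N \<kappa> k. prod_list (map p xs))"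
  using \<open>k \<le> s\<close>
proof (induction k)
  case 0
  then show ?case by (simp add: rainbow_lists_0)
next
  case (Suc k)
  let ?z = "max 0 (sum p N - (real s - 1))"
  have prod_nonneg: "0 \<le> prod_list (map p xs)" if "xs \<in> rainbow_lists N \<kappa> k" for xs
    using that nonneg by (intro prod_list_nonneg) (auto simp: rainbow_lists_def)
  have new: "?z \<le> sum p {x \<in> N. \<kappa> x \<notin> \<kappa> ` set xs}" if "xs \<in> rainbow_lists N \<kappa> k" for xs
  proof -
    have "card (\<kappa> ` set xs) \<le> k"
      using that card_image_le[of "set xs" \<kappa>] card_length[of xs] by (auto simp: rainbow_lists_def)
    have "sum p {x \<in> N. \<kappa> x \<in> \<kappa> ` set xs} = sum p (\<Union>c\<in>\<kappa> ` set xs. {x \<in> N. \<kappa> x = c})"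
      by (rule arg_cong[where f = "sum p"]) auto
    also have "\<dots> = (\<Sum>c\<in>\<kappa> ` set xs. sum p {x \<in> N. \<kappa> x = c})"
      using N by (intro sum.UNION_disjoint) auto
    also have "\<dots> \<le> (\<Sum>c\<in>\<kappa> ` set xs. 1)"
      by (intro sum_mono colour)
    also have "\<dots> \<le> real k" using \<open>card (\<kappa> ` set xs) \<le> k\<close> by simp
    finally have old: "sum p {x \<in> N. \<kappa> x \<in> \<kappa> ` set xs} \<le> real k" .
    have "sum p N = sum p {x \<in> N. \<kappa> x \<in> \<kappa> ` set xs} + sum p {x \<in> N. \<kappa> x \<notin> \<kappa> ` set xs}"
      using sum.Int_Diff[OF N, of p "{x. \<kappa> x \<in> \<kappa> ` set xs}"]
      by (simp add: Int_def set_diff_eq)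
    moreover have "0 \<le> sum p {x \<in> N. \<kappa> x \<notin> \<kappa> ` set xs}"
      using nonneg by (intro sum_nonneg) auto
    ultimately show ?thesis using old Suc.prems by auto
  qed
  have "?z ^ Suc k \<le> (\<Sum>xs\<in>rainbow_lists N \<kappa> k. prod_list (map p xs)) * ?z"
    unfolding power_Suc2 using Suc by (intro mult_right_mono) simp_all
  also have "\<dots> \<le> (\<Sum>xs\<in>rainbow_lists N \<kappa> k. prod_list (map p xs) * sum p {x \<in> N. \<kappa> x \<notin> \<kappa> ` set xs})"
    unfolding sum_distrib_right by (intro sum_mono mult_left_mono new prod_nonneg)
  finally show ?case unfolding rainbow_lists_sum_Suc[OF N] .
qed

text \<open>Each of the \<open>k\<close> positions contributes \<open>sum f A\<close> once for every
  filling of the other \<open>k - 1\<close> positions.\<close>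

lemma sum_lists_sum_list:
  fixes f :: "'a \<Rightarrow> real"
  assumes "finite A"
  shows "(\<Sum>xs | set xs \<subseteq> A \<and> length xs = k. sum_list (map f xs)) = real k * real (card A) ^ (k - 1) * sum f A"
proof (induction k)
  case 0
  have "{xs. set xs \<subseteq> A \<and> length xs = 0} = {[]}" by auto
  then show ?case by simp
next
  case (Suc k)
  let ?L = "{xs. set xs \<subseteq> A \<and> length xs = k}"
  have fin: "finite ?L" using assms by (rule finite_lists_length_eq)
  have "{xs. set xs \<subseteq> A \<and> length xs = Suc k} = (\<lambda>(x, xs). x # xs) ` (A \<times> ?L)"
    by (force simp: length_Suc_conv)
  then have "(\<Sum>xs | set xs \<subseteq> A \<and> length xs = Suc k. sum_list (map f xs))
    = (\<Sum>(x, xs)\<in>A \<times> ?L. f x + sum_list (map f xs))"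
    by (simp add: sum.reindex inj_on_def case_prod_unfold)
  also have "\<dots> = (\<Sum>x\<in>A. \<Sum>xs\<in>?L. f x + sum_list (map f xs))"
    by (simp add: sum.cartesian_product)
  also have "\<dots> = real (card ?L) * sum f A + real (card A) * (\<Sum>xs\<in>?L. sum_list (map f xs))"
    by (simp add: sum.distrib sum_distrib_left)
  also have "\<dots> = real (card A) ^ k * sum f A
      + real (card A) * (real k * real (card A) ^ (k - 1) * sum f A)"
    using Suc card_lists_length_eq[OF assms, of k] by simp
  also have "\<dots> = real (Suc k) * real (card A) ^ (Suc k - 1) * sum f A"
    \<comment> \<open>At \<open>k = 0\<close> the truncated exponent \<open>k - 1\<close> is
      harmless, since its term carries the factor \<open>k\<close>.\<close>
    by (cases k) (auto simp: algebra_simps)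
  finally show ?case .
qed

section \<open>Power means via tangents\<close>

lemma power_ge_tangent:
  fixes z \<mu> :: real
  assumes "0 \<le> z" and "0 < \<mu>"
  shows "\<mu> ^ s + real s * \<mu> ^ (s - 1) * (z - \<mu>) \<le> z ^ s"
proof (cases s)
  case (Suc m)
  \<comment> \<open>Bernoulli's inequality, rescaled by \<open>\<mu> ^ s\<close>, says that the
    power lies above its tangent at \<open>\<mu>\<close>.\<close>
  have "1 + real s * (z / \<mu> - 1) \<le> (1 + (z / \<mu> - 1)) ^ s"
    using assms by (intro Bernoulli_inequality) simp
  then have "\<mu> ^ s * (1 + real s * (z / \<mu> - 1)) \<le> \<mu> ^ s * (z / \<mu>) ^ s"
    using assms by (intro mult_left_mono) auto
  moreover have "\<mu> ^ s * (z / \<mu>) ^ s = z ^ s"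
    using assms by (simp add: power_divide)
  moreover have "\<mu> ^ s * (1 + real s * (z / \<mu> - 1)) = \<mu> ^ s + real s * \<mu> ^ (s - 1) * (z - \<mu>)"
    using assms Suc by (simp add: field_simps)
  ultimately show ?thesis by simp
qed simp

text \<open>Jensen's inequality for a power: sum the tangents at \<open>\<mu>\<close> with weights
  \<open>w\<close>. Since \<open>\<mu> * sum w V\<close> is at most the weighted sum of
  \<open>z\<close>, the linear terms add up to something nonnegative.\<close>

lemma weighted_power_mean:
  fixes w z :: "'a \<Rightarrow> real"
  assumes "\<And>v. v \<in> V \<Longrightarrow> 0 \<le> w v" and "\<And>v. v \<in> V \<Longrightarrow> 0 \<le> z v"
    and "0 < \<mu>" and "\<mu> * sum w V \<le> (\<Sum>v\<in>V. w v * z v)"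
  shows "\<mu> ^ s * sum w V \<le> (\<Sum>v\<in>V. w v * z v ^ s)"
proof -
  define c where "c = real s * \<mu> ^ (s - 1)"
  have "0 \<le> c" using assms by (simp add: c_def)
  have "\<mu> ^ s * sum w V \<le> \<mu> ^ s * sum w V + c * ((\<Sum>v\<in>V. w v * z v) - \<mu> * sum w V)"
    using assms \<open>0 \<le> c\<close> by simp
  also have "\<dots> = (\<Sum>v\<in>V. \<mu> ^ s * w v + (c * (w v * z v) - c * (\<mu> * w v)))"
    by (simp add: sum.distrib sum_subtractf right_diff_distrib flip: sum_distrib_left)
  also have "\<dots> = (\<Sum>v\<in>V. w v * (\<mu> ^ s + c * (z v - \<mu>)))"
    by (simp add: algebra_simps)
  also have "\<dots> \<le> (\<Sum>v\<in>V. w v * z v ^ s)"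
    using assms by (intro sum_mono mult_left_mono) (simp_all only: c_def power_ge_tangent)
  finally show ?thesis .
qed

section \<open>A weighted Kovari--Sos--Turan bound\<close>

locale simple_graph =
  fixes V :: "'a set" and E :: "'a rel"
  assumes finite_V: "finite V" and E_subset: "E \<subseteq> V \<times> V"
    and sym_E: "(u, v) \<in> E \<Longrightarrow> (v, u) \<in> E" and irrefl_E: "(v, v) \<notin> E"

text \<open>A properly coloured complete bipartite graph with sides \<open>X\<close> and
  \<open>T\<close>, expressed as injectivity of the colours at each vertex.\<close>

definition rainbow_biclique :: "'a rel \<Rightarrow> ('a set \<Rightarrow> 'c) \<Rightarrow> 'a set \<Rightarrow> 'a set \<Rightarrow> bool" where
  "rainbow_biclique E col X T \<longleftrightarrow> X \<times> T \<subseteq> E \<and>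
     (\<forall>v\<in>T. inj_on (\<lambda>x. col {v, x}) X) \<and> (\<forall>x\<in>X. inj_on (\<lambda>v. col {v, x}) T)"

lemma prod_list_le_factor:
  fixes f :: "'a \<Rightarrow> real"
  assumes "\<And>y. y \<in> set xs \<Longrightarrow> 0 \<le> f y \<and> f y \<le> 1" and "x \<in> set xs"
  shows "prod_list (map f xs) \<le> f x"
  using assms
proof (induction xs)
  case (Cons a xs)
  have le1: "prod_list (map f xs) \<le> 1" and ge0: "0 \<le> prod_list (map f xs)"
    using Cons.prems(1) by (induction xs) (auto intro: mult_le_one mult_nonneg_nonneg)
  show ?case
  proof (cases "x = a")
    case True
    then show ?thesis using le1 Cons.prems(1)[of a] by (simp add: mult_left_le)
  next
    case False
    then have "prod_list (map f xs) \<le> f x" using Cons by auto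
    then show ?thesis
      using ge0 Cons.prems(1)[of a] mult_left_le_one_le[OF ge0, of "f a"] by simp
  qed
qed simp

text \<open>\<open>W\<close> is the fractional edge packing, with capacity \<open>\<omega> x\<close>
  for every colour class at \<open>x\<close>.\<close>

locale weighted_coloured_graph = simple_graph V E
  for V :: "'a set" and E +
  fixes col :: "'a set \<Rightarrow> 'c" and \<omega> :: "'a \<Rightarrow> real" and W :: "'a \<Rightarrow> 'a \<Rightarrow> real"
  assumes \<omega>_pos: "0 < \<omega> v" and W_nonneg: "0 \<le> W u v" and W_sym: "W u v = W v u"
    and colour_class_le: "\<And>x c. x \<in> V \<Longrightarrow> (\<Sum>v | (x, v) \<in> E \<and> col {x, v} = c. W x v) \<le> \<omega> x"
begin

lemma finite_neighbours: "finite (E `` {v})"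
  using finite_V E_subset by (auto intro: finite_subset[of _ V])

lemma W_le: "W v x \<le> \<omega> v" if "(v, x) \<in> E"
proof -
  have "W v x \<le> (\<Sum>y | (v, y) \<in> E \<and> col {v, y} = col {v, x}. W v y)"
    using that finite_neighbours[of v] W_nonneg
    by (intro member_le_sum) (auto intro: finite_subset[of _ "E `` {v}"])
  also have "\<dots> \<le> \<omega> v" using that E_subset by (intro colour_class_le) auto
  finally show ?thesis .
qed

text \<open>
  A maximal set \<open>M\<close> of common neighbours no two of which agree in colour at a vertex of \<open>xs\<close> has
  fewer than \<open>t\<close> elements, and every common neighbour lies in a colour class of some
  \<open>x \<in> set xs\<close> meeting \<open>M\<close>; each such class has weight at most \<open>\<omega> x\<close>.
\<close>

lemma common_neighbours_le:
  fixes xs :: "'a list" and t :: nat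
  defines "A \<equiv> {v \<in> V. xs \<in> rainbow_lists (E `` {v}) (\<lambda>x. col {v, x}) (length xs)}"
  assumes "xs \<noteq> []"
    and no_biclique: "\<And>X T. rainbow_biclique E col X T \<Longrightarrow> card X = length xs \<Longrightarrow> card T \<noteq> t"
  shows "(\<Sum>v\<in>A. \<omega> v * prod_list (map (\<lambda>x. W v x / \<omega> v) xs)) \<le> real (t - 1) * sum_list (map \<omega> xs)"
proof (cases "A = {}")
  case True
  have "0 \<le> sum_list (map \<omega> xs)" by (intro sum_list_nonneg) (auto intro: less_imp_le \<omega>_pos)
  then show ?thesis unfolding True by simp
next
  case False
  have A: "set xs \<subseteq> E `` {v}" "inj_on (\<lambda>x. col {v, x}) (set xs)" "distinct xs" if "v \<in> A" for v
    using that by (auto simp: A_def rainbow_lists_def distinct_map)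
  have "finite A" using finite_V by (simp add: A_def)
  have "distinct xs" using False A by auto
  define free where "free M \<longleftrightarrow> M \<subseteq> A \<and> (\<forall>x\<in>set xs. inj_on (\<lambda>v. col {v, x}) M)" for M
  have "finite {M. free M}"
    by (rule finite_subset[of _ "Pow A"]) (use \<open>finite A\<close> in \<open>auto simp: free_def\<close>)
  moreover have "free {}" by (simp add: free_def)
  ultimately obtain M where M: "free M" and maximal: "\<And>M'. free M' \<Longrightarrow> M \<subseteq> M' \<Longrightarrow> M = M'"
    using finite_has_maximal[of "{M. free M}"] by auto
  have "finite M" using M \<open>finite A\<close> by (auto simp: free_def intro: finite_subset)
  \<comment> \<open>Any \<open>t\<close> elements of \<open>M\<close> would form a rainbow biclique
    with \<open>set xs\<close>.\<close>
  have "card M < t"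
  proof (rule ccontr)
    assume "\<not> card M < t"
    then obtain T where "T \<subseteq> M" "card T = t"
      by (meson not_less obtain_subset_with_card_n)
    moreover have "set xs \<times> T \<subseteq> E"
      using M A(1) \<open>T \<subseteq> M\<close> sym_E unfolding free_def by blast
    then have "rainbow_biclique E col (set xs) T"
      unfolding rainbow_biclique_def
      using M A(2) \<open>T \<subseteq> M\<close> by (auto simp: free_def intro: inj_on_subset)
    ultimately show False using no_biclique \<open>distinct xs\<close> distinct_card by blast
  qed
  have cover: "\<exists>m\<in>M. \<exists>x\<in>set xs. col {v, x} = col {m, x}" if v: "v \<in> A" for v
  proof (cases "v \<in> M")
    case True
    then show ?thesis using \<open>xs \<noteq> []\<close> by (cases xs) auto
  next
    case False
    then have "\<not> free (insert v M)" using maximal[of "insert v M"] by auto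
    then obtain x where "x \<in> set xs" "\<not> inj_on (\<lambda>v. col {v, x}) (insert v M)"
      using M v by (auto simp: free_def)
    moreover have "inj_on (\<lambda>v. col {v, x}) M" using M \<open>x \<in> set xs\<close> by (simp add: free_def)
    ultimately have "\<exists>m\<in>M. col {v, x} = col {m, x}" using False by (auto simp: image_iff)
    then show ?thesis using \<open>x \<in> set xs\<close> by auto
  qed
  \<comment> \<open>All factors \<open>W v x / \<omega> v\<close> lie in [0, 1], so the product is
    at most any single one of them; which \<open>x\<close> to keep is decided by
    \<open>cover\<close>.\<close>
  have term_le: "\<omega> v * prod_list (map (\<lambda>x. W v x / \<omega> v) xs) \<le> W v x" if "v \<in> A" "x \<in> set xs" for v x
  proof -
    have "prod_list (map (\<lambda>x. W v x / \<omega> v) xs) \<le> W v x / \<omega> v"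
      using that A(1)[OF that(1)]
      by (intro prod_list_le_factor) (auto simp: W_nonneg less_imp_le[OF \<omega>_pos] \<omega>_pos W_le)
    then show ?thesis using \<omega>_pos[of v] by (simp add: field_simps)
  qed
  \<comment> \<open>Each \<open>v\<close> is charged to the pairs \<open>(m, x)\<close> whose colour
    class contains it; by \<open>cover\<close> there is at least one.\<close>
  let ?h = "\<lambda>v m x. if col {v, x} = col {m, x} then W v x else 0"
  have "(\<Sum>v\<in>A. \<omega> v * prod_list (map (\<lambda>x. W v x / \<omega> v) xs)) \<le> (\<Sum>v\<in>A. \<Sum>m\<in>M. \<Sum>x\<in>set xs. ?h v m x)"
  proof (rule sum_mono)
    fix v assume "v \<in> A"
    then obtain m x where mx: "m \<in> M" "x \<in> set xs" "col {v, x} = col {m, x}" using cover by blast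
    have "\<omega> v * prod_list (map (\<lambda>x. W v x / \<omega> v) xs) \<le> ?h v m x"
      using term_le[OF \<open>v \<in> A\<close> mx(2)] mx(3) by simp
    also have "\<dots> \<le> (\<Sum>x\<in>set xs. ?h v m x)"
      using mx(2) by (intro member_le_sum) (auto simp: W_nonneg)
    also have "\<dots> \<le> (\<Sum>m\<in>M. \<Sum>x\<in>set xs. ?h v m x)"
      using mx(1) \<open>finite M\<close>
      by (intro member_le_sum[of m M "\<lambda>m. \<Sum>x\<in>set xs. ?h v m x"] sum_nonneg) (auto simp: W_nonneg)
    finally show "\<omega> v * prod_list (map (\<lambda>x. W v x / \<omega> v) xs) \<le> (\<Sum>m\<in>M. \<Sum>x\<in>set xs. ?h v m x)" .
  qed
  also have "\<dots> = (\<Sum>m\<in>M. \<Sum>v\<in>A. \<Sum>x\<in>set xs. ?h v m x)" by (rule sum.swap)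
  also have "\<dots> = (\<Sum>m\<in>M. \<Sum>x\<in>set xs. \<Sum>v\<in>A. ?h v m x)" by (intro sum.cong refl sum.swap)
  also have "\<dots> \<le> (\<Sum>m\<in>M. \<Sum>x\<in>set xs. \<omega> x)"
  proof (intro sum_mono)
    fix m x assume "m \<in> M" "x \<in> set xs"
    obtain v where "v \<in> A" using False by auto
    then have "(v, x) \<in> E" using A(1) \<open>x \<in> set xs\<close> by auto
    then have "x \<in> V" using E_subset by auto
    have "(\<Sum>v\<in>A. ?h v m x) = (\<Sum>v\<in>{v \<in> A. col {v, x} = col {m, x}}. W v x)"
      using \<open>finite A\<close> by (simp add: sum.inter_filter)
    also have "\<dots> = (\<Sum>v\<in>{v \<in> A. col {v, x} = col {m, x}}. W x v)"
      using W_sym by metis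
    also have "\<dots> \<le> (\<Sum>v | (x, v) \<in> E \<and> col {x, v} = col {m, x}. W x v)"
    proof (intro sum_mono2 W_nonneg)
      show "finite {v. (x, v) \<in> E \<and> col {x, v} = col {m, x}}"
        by (rule finite_subset[OF _ finite_neighbours[of x]]) auto
      show "{v \<in> A. col {v, x} = col {m, x}} \<subseteq> {v. (x, v) \<in> E \<and> col {x, v} = col {m, x}}"
        using A(1) \<open>x \<in> set xs\<close> sym_E by (fastforce simp: insert_commute)
    qed
    also have "\<dots> \<le> \<omega> x" by (rule colour_class_le[OF \<open>x \<in> V\<close>])
    finally show "(\<Sum>v\<in>A. ?h v m x) \<le> \<omega> x" .
  qed
  also have "\<dots> = real (card M) * sum_list (map \<omega> xs)"
    using \<open>distinct xs\<close> by (simp add: sum_list_distinct_conv_sum_set)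
  also have "\<dots> \<le> real (t - 1) * sum_list (map \<omega> xs)"
    using \<open>card M < t\<close>
    by (intro mult_right_mono sum_list_nonneg) (auto intro: less_imp_le \<omega>_pos)
  finally show ?thesis .
qed

text \<open>Double counting of pairs \<open>(v, xs)\<close> with \<open>xs\<close> a rainbow list of
  neighbours of \<open>v\<close>. For fixed \<open>v\<close>, \<open>rainbow_lists_sum_ge\<close>
  and the power mean give at least \<open>\<mu> ^ s * sum \<omega> V\<close> in total; for fixed
  \<open>xs\<close>, \<open>common_neighbours_le\<close> gives at most
  \<open>y ^ s * sum \<omega> V\<close> in total.\<close>

lemma total_weight_le:
  fixes s t :: nat and y :: real
  assumes "1 \<le> s" and "0 \<le> y" and y: "real (t - 1) * real s * real (card V) ^ (s - 1) \<le> y ^ s"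
    and no_biclique: "\<And>X T. rainbow_biclique E col X T \<Longrightarrow> card X = s \<Longrightarrow> card T \<noteq> t"
  shows "(\<Sum>(u, v)\<in>E. W u v) \<le> (y + real s - 1) * sum \<omega> V"
proof (rule ccontr)
  assume "\<not> ?thesis"
  then have less: "(y + real s - 1) * sum \<omega> V < (\<Sum>(u, v)\<in>E. W u v)" by simp
  have "V \<noteq> {}"
  proof
    assume "V = {}"
    then have "E = {}" using E_subset by auto
    then show False using less \<open>V = {}\<close> by simp
  qed
  then have \<Lambda>: "0 < sum \<omega> V" using finite_V \<omega>_pos by (intro sum_pos) auto
  let ?Q = "\<lambda>v. \<Sum>x\<in>E `` {v}. W v x / \<omega> v"
  let ?z = "\<lambda>v. max 0 (?Q v - (real s - 1))"
  let ?R = "\<lambda>v. rainbow_lists (E `` {v}) (\<lambda>x. col {v, x}) s"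
  let ?f = "\<lambda>v xs. \<omega> v * prod_list (map (\<lambda>x. W v x / \<omega> v) xs)"
  let ?L = "{xs. set xs \<subseteq> V \<and> length xs = s}"
  \<comment> \<open>The \<open>\<omega>\<close>-weighted mean of \<open>?Q v - (s - 1)\<close>; the
    negated claim says exactly that it exceeds \<open>y\<close>.\<close>
  define \<mu> where "\<mu> = (\<Sum>(u, v)\<in>E. W u v) / sum \<omega> V - (real s - 1)"
  have "y < \<mu>" using less \<Lambda> by (simp add: \<mu>_def field_simps)
  then have "0 < \<mu>" using \<open>0 \<le> y\<close> by simp
  have "(\<Sum>(u, v)\<in>E. W u v) = (\<Sum>v\<in>V. \<omega> v * ?Q v)"
    unfolding sum_rel_eq_sum_Image[OF finite_V finite_V E_subset]
    using \<omega>_pos by (auto simp: sum_distrib_left less_imp_neq[symmetric] intro!: sum.cong)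
  then have "\<mu> * sum \<omega> V = (\<Sum>v\<in>V. \<omega> v * ?Q v) - (real s - 1) * sum \<omega> V"
    using \<Lambda> by (simp add: \<mu>_def field_simps)
  also have "\<dots> = (\<Sum>v\<in>V. \<omega> v * (?Q v - (real s - 1)))"
    by (simp add: right_diff_distrib sum_subtractf sum_distrib_left mult.commute)
  also have "\<dots> \<le> (\<Sum>v\<in>V. \<omega> v * ?z v)"
    using \<omega>_pos by (intro sum_mono mult_left_mono) (auto intro: less_imp_le)
  finally have "\<mu> ^ s * sum \<omega> V \<le> (\<Sum>v\<in>V. \<omega> v * ?z v ^ s)"
    using \<open>0 < \<mu>\<close> \<omega>_pos by (intro weighted_power_mean) (auto intro: less_imp_le)
  also have "\<dots> \<le> (\<Sum>v\<in>V. \<Sum>xs\<in>?R v. ?f v xs)"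
  proof (rule sum_mono)
    fix v assume "v \<in> V"
    have "?z v ^ s \<le> (\<Sum>xs\<in>?R v. prod_list (map (\<lambda>x. W v x / \<omega> v) xs))"
    proof (intro rainbow_lists_sum_ge finite_neighbours)
      fix c
      have "{x \<in> E `` {v}. col {v, x} = c} = {x. (v, x) \<in> E \<and> col {v, x} = c}" by auto
      then show "(\<Sum>x | x \<in> E `` {v} \<and> col {v, x} = c. W v x / \<omega> v) \<le> 1"
        using colour_class_le[OF \<open>v \<in> V\<close>, of c] \<omega>_pos[of v] by (simp flip: sum_divide_distrib)
    qed (auto simp: W_nonneg less_imp_le[OF \<omega>_pos])
    then show "\<omega> v * ?z v ^ s \<le> (\<Sum>xs\<in>?R v. ?f v xs)"
      using \<omega>_pos[of v] by (simp flip: sum_distrib_left)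
  qed
  \<comment> \<open>A range of lists that does not depend on \<open>v\<close> allows the two sums to
    be exchanged.\<close>
  also have "\<dots> = (\<Sum>v\<in>V. \<Sum>xs\<in>?L. if xs \<in> ?R v then ?f v xs else 0)"
  proof (rule sum.cong[OF refl])
    fix v assume "v \<in> V"
    have "?R v = {xs \<in> ?L. xs \<in> ?R v}"
      using E_subset by (auto simp: rainbow_lists_def)
    then show "(\<Sum>xs\<in>?R v. ?f v xs) = (\<Sum>xs\<in>?L. if xs \<in> ?R v then ?f v xs else 0)"
      using finite_lists_length_eq[OF finite_V, of s] sum.inter_filter[of ?L "?f v" "\<lambda>xs. xs \<in> ?R v"]
      by simp
  qed
  also have "\<dots> = (\<Sum>xs\<in>?L. \<Sum>v\<in>V. if xs \<in> ?R v then ?f v xs else 0)" by (rule sum.swap)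
  also have "\<dots> = (\<Sum>xs\<in>?L. \<Sum>v\<in>{v \<in> V. xs \<in> ?R v}. ?f v xs)"
    using finite_V by (simp add: sum.inter_filter)
  also have "\<dots> \<le> (\<Sum>xs\<in>?L. real (t - 1) * sum_list (map \<omega> xs))"
  proof (rule sum_mono)
    fix xs assume "xs \<in> ?L"
    then show "(\<Sum>v\<in>{v \<in> V. xs \<in> ?R v}. ?f v xs) \<le> real (t - 1) * sum_list (map \<omega> xs)"
      using common_neighbours_le[of xs t] no_biclique \<open>1 \<le> s\<close> by fastforce
  qed
  also have "\<dots> = real (t - 1) * real s * real (card V) ^ (s - 1) * sum \<omega> V"
    using sum_lists_sum_list[OF finite_V, of \<omega> s] by (simp flip: sum_distrib_left)
  also have "\<dots> \<le> y ^ s * sum \<omega> V" using y \<Lambda> by simp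
  also have "\<dots> < \<mu> ^ s * sum \<omega> V"
    using \<open>y < \<mu>\<close> \<open>0 \<le> y\<close> \<open>1 \<le> s\<close> \<Lambda> by (simp add: power_strict_mono)
  finally show False by simp
qed

end

section \<open>Multiplicative weights and majority\<close>

text \<open>Potential argument: a vertex has weight \<open>exp\<close> of \<open>\<eta>\<close>
  times its past loss. A response to these weights has weighted average loss at most
  \<open>d\<close>, so one round multiplies the total weight by at most
  \<open>exp (\<eta> * d + (\<eta> * B)\<^sup>2)\<close>.\<close>

lemma multiplicative_weights_step:
  fixes l :: "'x \<Rightarrow> 'v \<Rightarrow> real"
  assumes bounds: "\<And>x v. x \<in> X \<Longrightarrow> v \<in> V \<Longrightarrow> 0 \<le> l x v \<and> l x v \<le> B"
    and response: "\<And>w. (\<And>v. 0 < w v) \<Longrightarrow> \<exists>x\<in>X. (\<Sum>v\<in>V. w v * l x v) \<le> d * sum w V"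
    and "0 \<le> \<eta>" and "\<eta> * B \<le> 1"
  shows "\<exists>x. (\<forall>\<tau><T. x \<tau> \<in> X) \<and>
    (\<Sum>v\<in>V. exp (\<eta> * (\<Sum>\<tau><T. l (x \<tau>) v))) \<le> real (card V) * exp (real T * (\<eta> * d + (\<eta> * B)\<^sup>2))"
proof (induction T)
  case (Suc T)
  then obtain x where x: "\<forall>\<tau><T. x \<tau> \<in> X"
    and pot: "(\<Sum>v\<in>V. exp (\<eta> * (\<Sum>\<tau><T. l (x \<tau>) v))) \<le> real (card V) * exp (real T * (\<eta> * d + (\<eta> * B)\<^sup>2))"
    by auto
  define w where "w v = exp (\<eta> * (\<Sum>\<tau><T. l (x \<tau>) v))" for v
  have w_pos: "0 < w v" for v by (simp add: w_def)
  obtain y where "y \<in> X" and y: "(\<Sum>v\<in>V. w v * l y v) \<le> d * sum w V"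
    using response[of w] w_pos by auto
  define x' where "x' = x(T := y)"
  let ?c = "\<eta> * d + (\<eta> * B)\<^sup>2"
  \<comment> \<open>The bound \<open>exp u \<le> 1 + u + u\<^sup>2\<close> is applied on [0, 1],
    hence the demand \<open>\<eta> * B \<le> 1\<close>.\<close>
  have exp_le: "exp (\<eta> * l y v) \<le> 1 + \<eta> * l y v + (\<eta> * B)\<^sup>2" if "v \<in> V" for v
  proof -
    have l: "0 \<le> l y v" "l y v \<le> B" using bounds[OF \<open>y \<in> X\<close> that] by auto
    have "\<eta> * l y v \<le> \<eta> * B" using l \<open>0 \<le> \<eta>\<close> by (simp add: mult_left_mono)
    moreover have "0 \<le> \<eta> * l y v" using l \<open>0 \<le> \<eta>\<close> by simp
    ultimately have "exp (\<eta> * l y v) \<le> 1 + \<eta> * l y v + (\<eta> * l y v)\<^sup>2" and "(\<eta> * l y v)\<^sup>2 \<le> (\<eta> * B)\<^sup>2"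
      using \<open>\<eta> * B \<le> 1\<close> by (auto intro!: exp_bound power_mono)
    then show ?thesis by simp
  qed
  have "(\<Sum>\<tau><Suc T. l (x' \<tau>) v) = (\<Sum>\<tau><T. l (x \<tau>) v) + l y v" for v
    by (simp add: x'_def)
  then have "(\<Sum>v\<in>V. exp (\<eta> * (\<Sum>\<tau><Suc T. l (x' \<tau>) v))) = (\<Sum>v\<in>V. w v * exp (\<eta> * l y v))"
    by (simp add: w_def distrib_left exp_add)
  also have "\<dots> \<le> (\<Sum>v\<in>V. w v * (1 + \<eta> * l y v + (\<eta> * B)\<^sup>2))"
    using w_pos by (intro sum_mono mult_left_mono exp_le) (auto intro: less_imp_le)
  also have "\<dots> = (1 + (\<eta> * B)\<^sup>2) * sum w V + \<eta> * (\<Sum>v\<in>V. w v * l y v)"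
    by (simp add: algebra_simps sum.distrib sum_distrib_left sum_distrib_right)
  also have "\<dots> \<le> (1 + (\<eta> * B)\<^sup>2) * sum w V + \<eta> * (d * sum w V)"
    using y \<open>0 \<le> \<eta>\<close> by (intro add_left_mono mult_left_mono)
  also have "\<dots> = (1 + ?c) * sum w V" by (simp add: algebra_simps)
  also have "\<dots> \<le> exp ?c * sum w V"
    using w_pos by (intro mult_right_mono sum_nonneg) (auto intro: less_imp_le)
  also have "\<dots> \<le> exp ?c * (real (card V) * exp (real T * ?c))"
    using pot by (simp add: w_def)
  also have "\<dots> = real (card V) * exp (real (Suc T) * ?c)"
    by (simp add: exp_add distrib_right)
  finally show ?case using x \<open>y \<in> X\<close> by (intro exI[of _ x']) (auto simp: x'_def less_Suc_eq)
qed simp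

text \<open>No single exponential exceeds the potential. Taking logarithms, the average loss at each
  vertex exceeds \<open>d\<close> by at most \<open>ln (card V) / (\<eta> * T)\<close> plus
  \<open>\<eta> * C\<^sup>2\<close>, each of which is made at most
  \<open>\<epsilon> / 2\<close>.\<close>

lemma multiplicative_weights:
  fixes l :: "'x \<Rightarrow> 'v \<Rightarrow> real"
  assumes "finite V"
    and bounds: "\<And>x v. x \<in> X \<Longrightarrow> v \<in> V \<Longrightarrow> 0 \<le> l x v \<and> l x v \<le> B"
    and response: "\<And>w. (\<And>v. 0 < w v) \<Longrightarrow> \<exists>x\<in>X. (\<Sum>v\<in>V. w v * l x v) \<le> d * sum w V"
    and "0 < \<epsilon>"
  shows "\<exists>T>0. \<exists>x. (\<forall>\<tau><T. x \<tau> \<in> X) \<and> (\<forall>v\<in>V. (\<Sum>\<tau><T. l (x \<tau>) v) \<le> real T * (d + \<epsilon>))"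
proof -
  \<comment> \<open>\<open>C\<close> replaces \<open>B\<close> in order to be positive. The first
    term of \<open>\<eta>\<close> ensures \<open>\<eta> * C \<le> 1\<close>, the second keeps the
    quadratic error at most \<open>\<epsilon> / 2\<close>.\<close>
  define C where "C = \<bar>B\<bar> + 1"
  define \<eta> where "\<eta> = min (1 / C) (\<epsilon> / (2 * C\<^sup>2))"
  have C: "0 < C" "B \<le> C" by (auto simp: C_def)
  have "0 < \<eta>" using C \<open>0 < \<epsilon>\<close> by (simp add: \<eta>_def)
  have "\<eta> * C \<le> 1" using C by (simp add: \<eta>_def min_def field_simps)
  have \<eta>_le: "\<eta> * C\<^sup>2 \<le> \<epsilon> / 2"
  proof -
    have "\<eta> * C\<^sup>2 \<le> \<epsilon> / (2 * C\<^sup>2) * C\<^sup>2" using C by (intro mult_right_mono) (auto simp: \<eta>_def)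
    then show ?thesis using C by simp
  qed
  obtain T :: nat where T: "ln (real (card V)) / (\<eta> * (\<epsilon> / 2)) < real T"
    using reals_Archimedean2 by blast
  define T' where "T' = Suc T"
  have "ln (real (card V)) / (\<eta> * (\<epsilon> / 2)) \<le> real T'" using T by (simp add: T'_def)
  then have T': "ln (real (card V)) \<le> real T' * (\<eta> * (\<epsilon> / 2))"
    using \<open>0 < \<eta>\<close> \<open>0 < \<epsilon>\<close> by (subst (asm) pos_divide_le_eq) auto
  obtain x where x: "\<forall>\<tau><T'. x \<tau> \<in> X"
    and pot: "(\<Sum>v\<in>V. exp (\<eta> * (\<Sum>\<tau><T'. l (x \<tau>) v)))
      \<le> real (card V) * exp (real T' * (\<eta> * d + (\<eta> * C)\<^sup>2))"
    using multiplicative_weights_step[of X V l C d \<eta> T'] bounds response \<open>0 < \<eta>\<close> \<open>\<eta> * C \<le> 1\<close> C(2)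
    by (smt (verit, best))
  have "(\<Sum>\<tau><T'. l (x \<tau>) v) \<le> real T' * (d + \<epsilon>)" if "v \<in> V" for v
  proof -
    have "0 < card V" using that \<open>finite V\<close> by (auto simp: card_gt_0_iff)
    have "exp (\<eta> * (\<Sum>\<tau><T'. l (x \<tau>) v)) \<le> (\<Sum>v\<in>V. exp (\<eta> * (\<Sum>\<tau><T'. l (x \<tau>) v)))"
      using that \<open>finite V\<close> by (intro member_le_sum) auto
    also note pot
    also have "real (card V) * exp (real T' * (\<eta> * d + (\<eta> * C)\<^sup>2))
        = exp (ln (real (card V)) + real T' * (\<eta> * d + (\<eta> * C)\<^sup>2))"
      using \<open>0 < card V\<close> by (simp add: exp_add)
    finally have "\<eta> * (\<Sum>\<tau><T'. l (x \<tau>) v) \<le> ln (real (card V)) + real T' * (\<eta> * d + (\<eta> * C)\<^sup>2)"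
      by simp
    also have "\<dots> \<le> real T' * (\<eta> * (\<epsilon> / 2)) + real T' * (\<eta> * d + \<eta> * (\<epsilon> / 2))"
    proof (intro add_mono T' mult_left_mono order.refl)
      have "(\<eta> * C)\<^sup>2 = \<eta> * (\<eta> * C\<^sup>2)" by (simp add: power2_eq_square)
      also have "\<dots> \<le> \<eta> * (\<epsilon> / 2)" using \<eta>_le \<open>0 < \<eta>\<close> by (intro mult_left_mono) auto
      finally show "(\<eta> * C)\<^sup>2 \<le> \<eta> * (\<epsilon> / 2)" .
    qed (use \<open>0 < \<eta>\<close> in simp_all)
    also have "\<dots> = \<eta> * (real T' * (d + \<epsilon>))" by (simp add: algebra_simps)
    finally show ?thesis using \<open>0 < \<eta>\<close> by simp
  qed
  then show ?thesis using x by (intro exI[of _ T']) (auto simp: T'_def)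
qed

text \<open>Double counting of the pairs \<open>(\<tau>, k)\<close> with \<open>R \<tau> k\<close>:
  every \<open>k\<close> with \<open>Q k\<close> occurs in at least half of the \<open>T\<close>
  rounds.\<close>

lemma card_majority_le:
  assumes "finite K" and majority: "\<And>k. k \<in> K \<Longrightarrow> Q k \<Longrightarrow> T \<le> 2 * card {\<tau>. \<tau> < T \<and> R \<tau> k}"
  shows "T * card {k \<in> K. Q k} \<le> 2 * (\<Sum>\<tau><T. card {k \<in> K. R \<tau> k})"
proof -
  have card_filter: "card {x \<in> A. p x} = (\<Sum>x\<in>A. if p x then 1 else 0)" if "finite A" for A and p :: "'b \<Rightarrow> bool"
    using sum.inter_filter[OF that, of "\<lambda>_. 1::nat" p] by simp
  have "T * card {k \<in> K. Q k} = (\<Sum>k\<in>K. if Q k then T else 0)"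
    using sum.inter_filter[OF assms(1), of "\<lambda>_. T" Q] by (simp add: mult.commute)
  also have "\<dots> \<le> (\<Sum>k\<in>K. 2 * (\<Sum>\<tau><T. if R \<tau> k then 1 else 0))"
    using majority card_filter[of "{..<T}"] by (intro sum_mono) (auto simp: lessThan_def)
  also have "\<dots> = 2 * (\<Sum>\<tau><T. \<Sum>k\<in>K. if R \<tau> k then 1 else 0)"
    unfolding sum_distrib_left[symmetric] by (subst sum.swap) (rule refl)
  also have "\<dots> = 2 * (\<Sum>\<tau><T. card {k \<in> K. R \<tau> k})"
    using card_filter[OF assms(1)] by simp
  finally show ?thesis .
qed

section \<open>Orientations of star forests\<close>

text \<open>A pair \<open>(u, c)\<close> in \<open>P\<close> is an edge with leaf \<open>u\<close>
  and chosen centre \<open>c\<close>. By \<open>leaf_unique\<close> its colour appears on no other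
  edge at \<open>u\<close>, so each colour class is a disjoint union of stars.\<close>

locale star_forest =
  fixes V :: "'a set" and P :: "'a rel" and col :: "'a set \<Rightarrow> 'c"
  assumes finite_V: "finite V" and P_subset: "P \<subseteq> V \<times> V" and P_asym: "(u, v) \<in> P \<Longrightarrow> (v, u) \<notin> P"
    and leaf_unique: "(u, c) \<in> P \<Longrightarrow> (u, w) \<in> P \<union> P\<inverse> \<Longrightarrow> col {u, w} = col {u, c} \<Longrightarrow> w = c"
begin

text \<open>Centre and colour together determine a star, so they serve as its name.\<close>

definition stars :: "('a \<times> 'c) set" where
  "stars = (\<lambda>(u, c). (c, col {u, c})) ` P"

text \<open>\<open>I\<close> is the set of stars directed towards their centres; all others point
  outwards.\<close>

definition orient :: "('a \<times> 'c) set \<Rightarrow> 'a rel" where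
  "orient I = {(u, c). (u, c) \<in> P \<and> (c, col {u, c}) \<in> I} \<union> {(c, u). (u, c) \<in> P \<and> (c, col {u, c}) \<notin> I}"

text \<open>Bounds the number of colours that \<open>v\<close> lacks on its out-arcs: one for each
  inward star centred at \<open>v\<close>, one for each outward star with leaf
  \<open>v\<close>.\<close>

definition loss :: "('a \<times> 'c) set \<Rightarrow> 'a \<Rightarrow> nat" where
  "loss I v = card {k \<in> stars `` {v}. (v, k) \<in> I} + card {c \<in> P `` {v}. (c, col {v, c}) \<notin> I}"

lemma finite_P: "finite P"
  using finite_V P_subset by (meson finite_SigmaI finite_subset)

lemma finite_stars: "finite stars"
  by (simp add: stars_def finite_P)

lemma finite_stars_Image: "finite (stars `` {v})"
  by (simp add: finite_stars)

lemma finite_P_Image: "finite (P `` {v})"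
  by (simp add: finite_P)

lemma orient_Un_converse: "orient I \<union> (orient I)\<inverse> = P \<union> P\<inverse>"
  by (auto simp: orient_def)

lemma orient_Int_converse: "orient I \<inter> (orient I)\<inverse> = {}"
  using P_asym by (auto simp: orient_def)

lemma orient_subset: "orient I \<subseteq> P \<union> P\<inverse>"
  using orient_Un_converse by blast

text \<open>If both arcs had one colour, \<open>leaf_unique\<close> would make \<open>z\<close> the
  centre of both, so they would lie in one star, directed inwards by the first arc and outwards by
  the second.\<close>

lemma orient_path_colours:
  assumes "(a, z) \<in> orient I" and "(z, b) \<in> orient I"
  shows "col {a, z} \<noteq> col {z, b}"
proof
  assume eq: "col {a, z} = col {z, b}"
  have adj: "(z, a) \<in> P \<union> P\<inverse>" "(z, b) \<in> P \<union> P\<inverse>"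
    using assms orient_subset by blast+
  have "a \<noteq> b" using assms orient_Int_converse by auto
  have "(z, a) \<notin> P"
    using leaf_unique[of z a b] adj eq \<open>a \<noteq> b\<close> by (auto simp: insert_commute)
  moreover have "(z, b) \<notin> P"
    using leaf_unique[of z b a] adj eq \<open>a \<noteq> b\<close> by (auto simp: insert_commute)
  ultimately have "(z, col {a, z}) \<in> I" "(z, col {b, z}) \<notin> I"
    using assms by (auto simp: orient_def)
  then show False using eq by (simp add: insert_commute)
qed

lemma colour_degree_le:
  "card ((\<lambda>w. col {v, w}) ` ((P \<union> P\<inverse>) `` {v})) \<le> card (orient I `` {v}) + loss I v"
proof -
  let ?c = "\<lambda>w. col {v, w}"
  let ?A = "{k \<in> stars `` {v}. (v, k) \<in> I}" and ?B = "{c \<in> P `` {v}. (c, col {v, c}) \<notin> I}"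
  have fin: "finite (orient I)"
    using finite_P orient_subset by (metis finite_Un finite_converse finite_subset)
  have fin_AB: "finite ?A" "finite ?B"
    using finite_subset[OF _ finite_stars_Image[of v], of ?A] finite_subset[OF _ finite_P_Image[of v], of ?B]
    by auto
  have "?c ` ((P \<union> P\<inverse>) `` {v}) \<subseteq> ?c ` (orient I `` {v}) \<union> (?A \<union> ?c ` ?B)"
    by (force simp: orient_def stars_def insert_commute image_iff)
  then have "card (?c ` ((P \<union> P\<inverse>) `` {v})) \<le> card (?c ` (orient I `` {v}) \<union> (?A \<union> ?c ` ?B))"
    using fin fin_AB by (intro card_mono finite_UnI finite_imageI) auto
  also have "\<dots> \<le> card (?c ` (orient I `` {v})) + (card ?A + card (?c ` ?B))"
    by (meson add_left_mono card_Un_le order.trans)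
  also have "\<dots> \<le> card (orient I `` {v}) + (card ?A + card ?B)"
    using fin fin_AB by (intro add_mono card_image_le) auto
  finally show ?thesis by (simp add: loss_def)
qed

text \<open>Ties go inwards. Whichever way \<open>M I T\<close> directs a star, at least half of the
  rounds agree, so each unit of loss recurs in at least half of them.\<close>

lemma loss_majority_le:
  defines "M I T \<equiv> {S. T \<le> 2 * card {\<tau>. \<tau> < T \<and> S \<in> I \<tau>}}"
  shows "T * loss (M I T) v \<le> 2 * (\<Sum>\<tau><T. loss (I \<tau>) v)"
proof -
  have split: "card {\<tau>. \<tau> < T \<and> S \<in> I \<tau>} + card {\<tau>. \<tau> < T \<and> S \<notin> I \<tau>} = T" for S
  proof -
    have "card ({\<tau>. \<tau> < T \<and> S \<in> I \<tau>} \<union> {\<tau>. \<tau> < T \<and> S \<notin> I \<tau>}) = card {..<T}"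
      by (rule arg_cong[where f = card]) auto
    then show ?thesis by (subst (asm) card_Un_disjoint) auto
  qed
  have "T * card {k \<in> stars `` {v}. (v, k) \<in> M I T}
      \<le> 2 * (\<Sum>\<tau><T. card {k \<in> stars `` {v}. (v, k) \<in> I \<tau>})"
    by (intro card_majority_le finite_stars_Image) (simp add: M_def)
  moreover have "T * card {c \<in> P `` {v}. (c, col {v, c}) \<notin> M I T}
      \<le> 2 * (\<Sum>\<tau><T. card {c \<in> P `` {v}. (c, col {v, c}) \<notin> I \<tau>})"
  proof (intro card_majority_le finite_P_Image)
    fix c assume "(c, col {v, c}) \<notin> M I T"
    then show "T \<le> 2 * card {\<tau>. \<tau> < T \<and> (c, col {v, c}) \<notin> I \<tau>}"
      using split[of "(c, col {v, c})"] by (simp add: M_def)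
  qed
  ultimately show ?thesis
    by (simp add: loss_def sum.distrib algebra_simps)
qed

text \<open>A crude bound independent of \<open>I\<close> and \<open>v\<close>, serving as the
  \<open>B\<close> of \<open>multiplicative_weights\<close>.\<close>

lemma loss_le: "loss I v \<le> card stars + card P"
proof -
  have "card {k \<in> stars `` {v}. (v, k) \<in> I} \<le> card (snd ` stars)"
    using finite_stars by (intro card_mono) force+
  also have "\<dots> \<le> card stars" by (intro card_image_le finite_stars)
  finally have 1: "card {k \<in> stars `` {v}. (v, k) \<in> I} \<le> card stars" .
  have "card {c \<in> P `` {v}. (c, col {v, c}) \<notin> I} \<le> card (snd ` P)"
    using finite_P by (intro card_mono) force+
  also have "\<dots> \<le> card P" by (intro card_image_le finite_P)
  finally show ?thesis using 1 by (simp add: loss_def)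
qed

lemma simple_graph: "simple_graph V (P \<union> P\<inverse>)"
  using finite_V P_subset P_asym by unfold_locales auto

text \<open>
  Let each star be paid for by the cheaper of its centre and its leaves. The price, distributed over
  the edges of the star proportionally to the weights of the leaves, loads no colour class at a
  vertex \<open>x\<close> with more than \<open>\<omega> x\<close>, so it is bounded by \<open>total_weight_le\<close>. The factor \<open>1 / 2\<close> arises
  because that bound counts each edge in both directions.
\<close>

lemma best_response:
  fixes \<omega> :: "'a \<Rightarrow> real" and y :: real
  assumes \<omega>_pos: "\<And>v. 0 < \<omega> v" and "1 \<le> s" and "0 \<le> y"
    and y: "real (t - 1) * real s * real (card V) ^ (s - 1) \<le> y ^ s"
    and no_biclique: "\<And>X T. rainbow_biclique (P \<union> P\<inverse>) col X T \<Longrightarrow> card X = s \<Longrightarrow> card T \<noteq> t"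
  shows "\<exists>I. (\<Sum>v\<in>V. \<omega> v * real (loss I v)) \<le> (y + real s - 1) / 2 * sum \<omega> V"
proof -
  define leaves where "leaves c k = {u. (u, c) \<in> P \<and> col {u, c} = k}" for c k
  have finite_leaves: "finite (leaves c k)" for c k
    using finite_V P_subset by (auto simp: leaves_def intro: finite_subset[of _ V])
  \<comment> \<open>A star is directed inwards exactly when its centre weighs no more than its
    leaves together; \<open>q u c\<close> is then the share of leaf \<open>u\<close> in the price
    \<open>\<omega> c\<close>, and otherwise the weight of \<open>u\<close> itself.\<close>
  define I where "I = {(c, k). (c, k) \<in> stars \<and> \<omega> c \<le> sum \<omega> (leaves c k)}"
  define q where "q u c = (if (c, col {u, c}) \<in> I then \<omega> c / sum \<omega> (leaves c (col {u, c})) * \<omega> u else \<omega> u)"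
    for u c
  define W where "W u v = (if (u, v) \<in> P then q u v else if (v, u) \<in> P then q v u else 0)" for u v
  have leaves_nonneg: "0 \<le> sum \<omega> (leaves c k)" for c k
    using \<omega>_pos by (intro sum_nonneg) (auto intro: less_imp_le)
  have q_nonneg: "0 \<le> q u c" for u c
    using \<omega>_pos leaves_nonneg by (simp add: q_def less_imp_le)
  have q_le: "q u c \<le> \<omega> u" for u c
  proof (cases "(c, col {u, c}) \<in> I")
    case True
    then have "\<omega> c / sum \<omega> (leaves c (col {u, c})) \<le> 1"
      using \<omega>_pos[of c] by (simp add: I_def)
    then show ?thesis
      using True \<omega>_pos[of u] mult_right_mono[of "\<omega> c / sum \<omega> (leaves c (col {u, c}))" 1 "\<omega> u"]
      by (simp add: q_def)
  qed (simp add: q_def)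
  have q_leaves: "(\<Sum>u\<in>leaves c k. q u c) = (if (c, k) \<in> I then \<omega> c else sum \<omega> (leaves c k))" for c k
  proof -
    have "(\<Sum>u\<in>leaves c k. q u c)
      = (\<Sum>u\<in>leaves c k. if (c, k) \<in> I then \<omega> c / sum \<omega> (leaves c k) * \<omega> u else \<omega> u)"
      by (intro sum.cong) (auto simp: q_def leaves_def)
    moreover have "sum \<omega> (leaves c k) \<noteq> 0" if "(c, k) \<in> I"
      using that \<omega>_pos[of c] by (simp add: I_def)
    ultimately show ?thesis by (simp flip: sum_distrib_left sum_divide_distrib)
  qed
  \<comment> \<open>Where \<open>x\<close> is a leaf in colour \<open>k\<close>, the class is a
    single edge, priced at most \<open>\<omega> x\<close>. Otherwise it consists of the edges from
    \<open>leaves x k\<close>, whose total price is the minimum of \<open>\<omega> x\<close> and the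
    leaf weight.\<close>
  have colour_class: "(\<Sum>v | (x, v) \<in> P \<union> P\<inverse> \<and> col {x, v} = k. W x v) \<le> \<omega> x" for x k
  proof (cases "\<exists>c. (x, c) \<in> P \<and> col {x, c} = k")
    case True
    then obtain c where c: "(x, c) \<in> P" "col {x, c} = k" by auto
    then have "{v. (x, v) \<in> P \<union> P\<inverse> \<and> col {x, v} = k} = {c}" using leaf_unique[of x c] by auto
    then show ?thesis using c q_le by (simp add: W_def)
  next
    case False
    then have "{v. (x, v) \<in> P \<union> P\<inverse> \<and> col {x, v} = k} = leaves x k"
      by (auto simp: leaves_def insert_commute)
    then have "(\<Sum>v | (x, v) \<in> P \<union> P\<inverse> \<and> col {x, v} = k. W x v) = (\<Sum>u\<in>leaves x k. q u x)"
      using P_asym by (auto simp: W_def leaves_def intro!: sum.cong)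
    also have "\<dots> \<le> \<omega> x"
    proof (cases "leaves x k = {}")
      case True
      then show ?thesis using \<omega>_pos[of x] by simp
    next
      case False
      then have "(x, k) \<in> stars" by (force simp: leaves_def stars_def)
      then show ?thesis unfolding q_leaves by (auto simp: I_def)
    qed
    finally show ?thesis .
  qed
  interpret weighted_coloured_graph V "P \<union> P\<inverse>" col \<omega> W
    using simple_graph colour_class \<omega>_pos q_nonneg P_asym
    by (intro weighted_coloured_graph.intro weighted_coloured_graph_axioms.intro) (auto simp: W_def)
  have "(\<Sum>(u, v)\<in>P \<union> P\<inverse>. W u v) = (\<Sum>(u, v)\<in>P. W u v) + (\<Sum>(u, v)\<in>P\<inverse>. W u v)"
    using finite_P P_asym by (intro sum.union_disjoint) auto
  also have "(\<Sum>(u, v)\<in>P\<inverse>. W u v) = (\<Sum>(u, v)\<in>P. W v u)"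
    by (intro sum.reindex_bij_witness[of _ prod.swap prod.swap]) auto
  also have "(\<Sum>(u, v)\<in>P. W v u) = (\<Sum>(u, v)\<in>P. q u v)"
    using P_asym by (intro sum.cong) (auto simp: W_def)
  also have "(\<Sum>(u, v)\<in>P. W u v) = (\<Sum>(u, v)\<in>P. q u v)"
    by (intro sum.cong) (auto simp: W_def)
  finally have W_total: "(\<Sum>(u, v)\<in>P \<union> P\<inverse>. W u v) = 2 * (\<Sum>(u, v)\<in>P. q u v)" by simp
  let ?in = "{(u, c). (u, c) \<in> P \<and> (c, col {u, c}) \<in> I}"
  let ?out = "{(u, c). (u, c) \<in> P \<and> (c, col {u, c}) \<notin> I}"
  have fin: "finite ?in" "finite ?out" by (auto intro: finite_subset[OF _ finite_P])
  have "I \<subseteq> stars" by (auto simp: I_def)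
  then have "finite I" using finite_stars finite_subset by blast
  have "(\<Sum>v\<in>V. \<omega> v * real (card {k \<in> stars `` {v}. (v, k) \<in> I})) = (\<Sum>v\<in>V. \<Sum>k\<in>I `` {v}. \<omega> v)"
  proof (intro sum.cong refl)
    fix v
    have "{k \<in> stars `` {v}. (v, k) \<in> I} = I `` {v}" using \<open>I \<subseteq> stars\<close> by auto
    then show "\<omega> v * real (card {k \<in> stars `` {v}. (v, k) \<in> I}) = (\<Sum>k\<in>I `` {v}. \<omega> v)" by simp
  qed
  also have "\<dots> = (\<Sum>(c, k)\<in>I. \<omega> c)"
  proof (rule sum_rel_eq_sum_Image[symmetric, OF finite_V finite_imageI[OF finite_stars, of snd]])
    show "I \<subseteq> V \<times> snd ` stars" using P_subset by (force simp: I_def stars_def)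
  qed
  also have "\<dots> = (\<Sum>(c, k)\<in>I. \<Sum>u\<in>leaves c k. q u c)"
    by (intro sum.cong) (auto simp: q_leaves)
  \<comment> \<open>Grouping edges by their star turns the sum over inward stars into one over their
    edges.\<close>
  also have "\<dots> = (\<Sum>S\<in>I. \<Sum>(u, c)\<in>{e \<in> ?in. (case e of (u, c) \<Rightarrow> (c, col {u, c})) = S}. q u c)"
  proof (intro sum.cong refl)
    fix S assume "S \<in> I"
    obtain c k where S: "S = (c, k)" by force
    have "{e \<in> ?in. (case e of (u, c) \<Rightarrow> (c, col {u, c})) = S} = (\<lambda>u. (u, c)) ` leaves c k"
      using \<open>S \<in> I\<close> by (auto simp: S leaves_def)
    then show "(case S of (c, k) \<Rightarrow> \<Sum>u\<in>leaves c k. q u c)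
      = (\<Sum>(u, c)\<in>{e \<in> ?in. (case e of (u, c) \<Rightarrow> (c, col {u, c})) = S}. q u c)"
      by (simp add: S sum.reindex inj_on_def)
  qed
  also have "\<dots> = (\<Sum>(u, c)\<in>?in. q u c)"
    using fin \<open>finite I\<close> by (intro sum.group) auto
  finally have loss_in: "(\<Sum>v\<in>V. \<omega> v * real (card {k \<in> stars `` {v}. (v, k) \<in> I})) = (\<Sum>(u, c)\<in>?in. q u c)" .
  have "(\<Sum>v\<in>V. \<omega> v * real (card {c \<in> P `` {v}. (c, col {v, c}) \<notin> I})) = (\<Sum>v\<in>V. \<Sum>c\<in>?out `` {v}. \<omega> v)"
  proof (intro sum.cong refl)
    fix v
    have "{c \<in> P `` {v}. (c, col {v, c}) \<notin> I} = ?out `` {v}" by auto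
    then show "\<omega> v * real (card {c \<in> P `` {v}. (c, col {v, c}) \<notin> I}) = (\<Sum>c\<in>?out `` {v}. \<omega> v)" by simp
  qed
  also have "\<dots> = (\<Sum>(u, c)\<in>?out. \<omega> u)"
    by (rule sum_rel_eq_sum_Image[symmetric, OF finite_V finite_V]) (use P_subset in auto)
  also have "\<dots> = (\<Sum>(u, c)\<in>?out. q u c)"
    by (intro sum.cong) (auto simp: q_def)
  finally have loss_out:
    "(\<Sum>v\<in>V. \<omega> v * real (card {c \<in> P `` {v}. (c, col {v, c}) \<notin> I})) = (\<Sum>(u, c)\<in>?out. q u c)" .
  have "(\<Sum>v\<in>V. \<omega> v * real (loss I v)) = (\<Sum>(u, c)\<in>?in. q u c) + (\<Sum>(u, c)\<in>?out. q u c)"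
    unfolding loss_in[symmetric] loss_out[symmetric]
    by (simp add: loss_def distrib_left sum.distrib)
  also have "\<dots> = (\<Sum>(u, c)\<in>?in \<union> ?out. q u c)"
    using fin by (intro sum.union_disjoint[symmetric]) auto
  also have "?in \<union> ?out = P" by auto
  finally have "2 * (\<Sum>v\<in>V. \<omega> v * real (loss I v)) \<le> (y + real s - 1) * sum \<omega> V"
    using total_weight_le[OF \<open>1 \<le> s\<close> \<open>0 \<le> y\<close> y no_biclique] W_total by simp
  then show ?thesis by (intro exI[of _ I]) simp
qed

text \<open>\<open>best_response\<close> supplies the rounds of
  \<open>multiplicative_weights\<close>, with average loss about \<open>?d\<close>; the majority
  doubles this, which cancels the \<open>1 / 2\<close> in \<open>?d\<close>.\<close>

lemma exists_orientation_loss_less: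
  fixes y :: real
  assumes "1 \<le> s" and "0 \<le> y"
    and y: "real (t - 1) * real s * real (card V) ^ (s - 1) \<le> y ^ s"
    and no_biclique: "\<And>X T. rainbow_biclique (P \<union> P\<inverse>) col X T \<Longrightarrow> card X = s \<Longrightarrow> card T \<noteq> t"
  shows "\<exists>I. \<forall>v\<in>V. real (loss I v) < y + real s"
proof -
  let ?d = "(y + real s - 1) / 2"
  \<comment> \<open>Doubling turns the error \<open>1 / 4\<close> into \<open>1 / 2\<close>, which
    the \<open>- 1\<close> in \<open>?d\<close> absorbs; hence the strict bound.\<close>
  have "\<exists>T>0. \<exists>I. (\<forall>\<tau><T. I \<tau> \<in> UNIV) \<and>
      (\<forall>v\<in>V. (\<Sum>\<tau><T. real (loss (I \<tau>) v)) \<le> real T * (?d + 1 / 4))"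
  proof (rule multiplicative_weights[OF finite_V])
    fix I v
    show "0 \<le> real (loss I v) \<and> real (loss I v) \<le> real (card stars + card P)"
      using loss_le[of I v] by (simp del: of_nat_add)
  next
    fix \<omega> :: "'a \<Rightarrow> real" assume "\<And>v. 0 < \<omega> v"
    then show "\<exists>I\<in>UNIV. (\<Sum>v\<in>V. \<omega> v * real (loss I v)) \<le> ?d * sum \<omega> V"
      using best_response[OF _ assms] by simp
  qed simp
  then obtain T :: nat and I where "0 < T"
    and I: "\<forall>v\<in>V. (\<Sum>\<tau><T. real (loss (I \<tau>) v)) \<le> real T * (?d + 1 / 4)"
    by auto
  define M where "M = {S. T \<le> 2 * card {\<tau>. \<tau> < T \<and> S \<in> I \<tau>}}"
  have "real (loss M v) < y + real s" if "v \<in> V" for v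
  proof -
    have "real (T * loss M v) \<le> real (2 * (\<Sum>\<tau><T. loss (I \<tau>) v))"
      unfolding M_def of_nat_le_iff by (rule loss_majority_le)
    also have "\<dots> \<le> 2 * (real T * (?d + 1 / 4))" using I that by simp
    also have "\<dots> < real T * (y + real s)" using \<open>0 < T\<close> by (simp add: field_simps)
    finally show ?thesis using \<open>0 < T\<close> by simp
  qed
  then show ?thesis by blast
qed

end

section \<open>Extraction of a star forest\<close>

text \<open>
  In an edge-minimal subgraph with the same colours at every vertex, each edge carries a colour that
  is unique at one of its ends, so every colour class is a disjoint union of stars.
\<close>

lemma (in simple_graph) exists_star_forest:
  fixes col :: "'a set \<Rightarrow> 'c"
  shows
  "\<exists>P. star_forest V P col \<and> P \<union> P\<inverse> \<subseteq> E \<and>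
     (\<forall>v. (\<lambda>w. col {v, w}) ` ((P \<union> P\<inverse>) `` {v}) = (\<lambda>w. col {v, w}) ` (E `` {v}))"
proof -
  define colours where "colours F v = (\<lambda>w. col {v, w}) ` (F `` {v})" for F :: "'a rel" and v
  define good where "good F \<longleftrightarrow> F \<subseteq> E \<and> sym F \<and> (\<forall>v. colours F v = colours E v)" for F
  have "finite E" using finite_V E_subset by (meson finite_SigmaI finite_subset)
  then have "finite {F. good F}"
    by (intro finite_subset[of "{F. good F}" "Pow E"]) (auto simp: good_def)
  moreover have "good E" using sym_E by (auto simp: good_def intro: symI)
  ultimately obtain F where F: "good F" and minimal: "\<And>F'. good F' \<Longrightarrow> F' \<subseteq> F \<Longrightarrow> F = F'"
    using finite_has_minimal[of "{F. good F}"] by auto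
  have symF: "(v, u) \<in> F" if "(u, v) \<in> F" for u v
    using F that by (auto simp: good_def dest: symD)
  have irreflF: "(v, v) \<notin> F" for v using F irrefl_E by (auto simp: good_def)
  define unique where "unique u c \<longleftrightarrow> (\<forall>w. (u, w) \<in> F \<longrightarrow> col {u, w} = col {u, c} \<longrightarrow> w = c)" for u c
  have unique: "unique u v \<or> unique v u" if "(u, v) \<in> F" for u v
  proof (rule ccontr)
    assume "\<not> (unique u v \<or> unique v u)"
    then obtain a b where a: "(u, a) \<in> F" "col {u, a} = col {u, v}" "a \<noteq> v"
      and b: "(v, b) \<in> F" "col {v, b} = col {v, u}" "b \<noteq> u"
      by (auto simp: unique_def)
    \<comment> \<open>Both ends see the colour of the edge elsewhere, via \<open>a\<close> and
      \<open>b\<close>, so deleting it loses no colour at any vertex, against minimality.\<close>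
    define F' where "F' = F - {(u, v), (v, u)}"
    have "u \<noteq> v" using that irreflF by auto
    have "colours F' w = colours F w" for w
    proof (rule antisym)
      show "colours F w \<subseteq> colours F' w"
      proof
        fix k assume "k \<in> colours F w"
        then obtain x where x: "(w, x) \<in> F" "k = col {w, x}" by (auto simp: colours_def)
        have "(u, a) \<in> F'" "(v, b) \<in> F'" using a b \<open>u \<noteq> v\<close> by (auto simp: F'_def)
        then have "\<exists>y. (w, y) \<in> F' \<and> k = col {w, y}"
          using x a b by (cases "(w, x) \<in> F'") (auto simp: F'_def)
        then show "k \<in> colours F' w" by (auto simp: colours_def)
      qed
    qed (auto simp: F'_def colours_def)
    then have "good F'"
      using F by (auto simp: good_def F'_def sym_def)
    then have "F = F'" by (rule minimal) (auto simp: F'_def)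
    then show False using that by (auto simp: F'_def)
  qed
  \<comment> \<open>Choosing from the unordered edge gives both directions the same centre, also
    when either end could be the leaf.\<close>
  define centre where "centre e = (SOME c. \<exists>u. e = {u, c} \<and> unique u c)" for e
  define P where "P = {(u, c) \<in> F. centre {u, c} = c}"
  have centre: "centre {u, v} = v \<and> unique u v \<or> centre {u, v} = u \<and> unique v u" if "(u, v) \<in> F" for u v
  proof -
    have "\<exists>c w. {u, v} = {w, c} \<and> unique w c"
      using unique[OF that] by (metis insert_commute)
    then have "\<exists>w. {u, v} = {w, centre {u, v}} \<and> unique w (centre {u, v})"
      unfolding centre_def by (rule someI_ex)
    then show ?thesis by (auto simp: doubleton_eq_iff)
  qed
  have P_F: "P \<union> P\<inverse> = F"
    using centre symF by (fastforce simp: P_def insert_commute)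
  have "star_forest V P col"
  proof
    show "finite V" by (rule finite_V)
    show "P \<subseteq> V \<times> V" using F E_subset by (auto simp: P_def good_def)
  next
    fix u v assume "(u, v) \<in> P"
    then show "(v, u) \<notin> P" using irreflF by (auto simp: P_def insert_commute)
  next
    fix u c w assume "(u, c) \<in> P" and w: "(u, w) \<in> P \<union> P\<inverse>" "col {u, w} = col {u, c}"
    then have "(u, c) \<in> F" "centre {u, c} = c" by (auto simp: P_def)
    then have "unique u c" using centre[of u c] irreflF by auto
    then show "w = c" using w unfolding P_F unique_def by blast
  qed
  then show ?thesis using F unfolding good_def colours_def by (intro exI[of _ P]) (simp add: P_F)
qed

section \<open>Orienting the whole graph\<close>

text \<open>Distinct arcs of a directed cycle share neither tail nor head, so two edges that meet
  come from consecutive arcs, to which \<open>path\<close> applies. Antisymmetry excludes lengths 1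
  and 2.\<close>

lemma directed_cycle_properly_coloured:
  assumes "parcs D \<subseteq> parcs H" and "pverts D = pverts H"
    and asym: "parcs D \<inter> (parcs D)\<inverse> = {}"
    and path: "\<And>a z b. (a, z) \<in> parcs D \<Longrightarrow> (z, b) \<in> parcs D \<Longrightarrow> col {a, z} \<noteq> col {z, b}"
    and cycle: "pre_digraph.cycle (with_proj D) p"
  shows "properly_coloured_cycle H col p"
proof -
  obtain u where u: "u \<in> pverts D" and arcs: "set p \<subseteq> parcs D" and cas: "pcas u p u"
    and dist: "distinct (tl (pawalk_verts u p))" and "p \<noteq> []"
    using cycle by (auto simp: pre_digraph.cycle_def pre_digraph.awalk_def cas_with_proj_eq
        awalk_verts_with_proj_eq)
  have "pawalk_verts u p = map fst p @ [snd (last p)]"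
    using pre_digraph.awalk_verts_conv[of "with_proj D" u p] \<open>p \<noteq> []\<close>
    by (simp add: awalk_verts_with_proj_eq)
  moreover have heads: "pawalk_verts u p = fst (hd p) # map snd p"
    using pre_digraph.awalk_verts_conv'[of "with_proj D" u p u] cas \<open>p \<noteq> []\<close>
    by (simp add: awalk_verts_with_proj_eq cas_with_proj_eq)
  moreover have "fst (hd p) = u" using cas \<open>p \<noteq> []\<close> by (cases p) auto
  moreover have "snd (last q) = b" if "pcas a q b" "q \<noteq> []" for a b :: 'a and q
    using that by (induction q arbitrary: a) auto
  then have "snd (last p) = u" using cas \<open>p \<noteq> []\<close> .
  ultimately have "map fst p @ [u] = u # map snd p" by simp
  \<comment> \<open>Distinctness is given for the heads; as the walk is closed, the tails form the
    same multiset.\<close>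
  then have "mset (map fst p @ [u]) = mset (u # map snd p)" by (rule arg_cong)
  then have "mset (map fst p) = mset (map snd p)" by simp
  moreover have inj_snd: "distinct (map snd p)" using dist heads by simp
  ultimately have "distinct (map fst p)" using mset_eq_imp_distinct_iff by blast
  have same_tail: "e = f" if "e \<in> set p" "f \<in> set p" "fst e = fst f" for e f
    using that \<open>distinct (map fst p)\<close> by (auto simp: distinct_map dest: inj_onD)
  have same_head: "e = f" if "e \<in> set p" "f \<in> set p" "snd e = snd f" for e f
    using that inj_snd by (auto simp: distinct_map dest: inj_onD)
  have "3 \<le> length p"
  proof (rule ccontr)
    assume "\<not> 3 \<le> length p"
    then consider e where "p = [e]" | e f where "p = [e, f]"
      using \<open>p \<noteq> []\<close> by (cases p; cases "tl p"; cases "tl (tl p)") auto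
    then show False
    proof cases
      case 1
      then show False using cas arcs asym by (cases e) auto
    next
      case 2
      then show False using cas arcs asym by (cases e; cases f) auto
    qed
  qed
  moreover have "pre_digraph.cycle (with_proj H) p"
    using u arcs cas dist \<open>p \<noteq> []\<close> assms(1,2)
    by (auto simp: pre_digraph.cycle_def pre_digraph.awalk_def cas_with_proj_eq awalk_verts_with_proj_eq)
  moreover have "properly_coloured (edges_of (set p)) col"
    unfolding properly_coloured_def
  proof (intro ballI impI)
    fix e f assume "e \<in> edges_of (set p)" "f \<in> edges_of (set p)" and ef: "e \<noteq> f \<and> e \<inter> f \<noteq> {}"
    then obtain a b c d where ab: "(a, b) \<in> set p" "e = {a, b}" and cd: "(c, d) \<in> set p" "f = {c, d}"
      by (auto simp: edges_of_def)
    have "a \<noteq> c" "b \<noteq> d" using same_tail[OF ab(1) cd(1)] same_head[OF ab(1) cd(1)] ef ab cd by auto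
    then have "b = c \<or> d = a" using ef ab cd by auto
    then show "col e \<noteq> col f"
      using path[of a b d] path[of c d b] ab cd arcs by (metis subsetD)
  qed
  ultimately show ?thesis by (simp add: properly_coloured_cycle_def)
qed

text \<open>\<open>X\<close> and \<open>T\<close> are disjoint because there are no loops, so
  distinct edges that meet share a vertex on exactly one side, where injectivity separates their
  colours.\<close>

lemma has_properly_coloured_complete_bipartite_if_rainbow_biclique:
  assumes "pair_graph G" and rb: "rainbow_biclique E col X T" and "E \<subseteq> parcs G"
    and "card X = s" and "card T = t" and "X \<noteq> {}" and "T \<noteq> {}"
  shows "has_properly_coloured_complete_bipartite s t G col"
proof -
  interpret pair_graph G by fact
  define K where "K = \<lparr>pverts = X \<union> T, parcs = X \<times> T \<union> T \<times> X\<rparr>"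
  have XT: "X \<times> T \<subseteq> parcs G" using rb \<open>E \<subseteq> parcs G\<close> by (auto simp: rainbow_biclique_def)
  then have TX: "T \<times> X \<subseteq> parcs G" using arcs_symmetric by auto
  have "X \<inter> T = {}" using XT no_loops' by blast
  \<comment> \<open>Both sides are nonempty, so each of their vertices lies on an edge and hence in
    \<open>G\<close>.\<close>
  have verts: "X \<union> T \<subseteq> pverts G"
    using XT TX \<open>X \<noteq> {}\<close> \<open>T \<noteq> {}\<close> in_arcsD1 by blast
  then have "finite (X \<union> T)" using pair_finite_verts finite_subset by blast
  have bip: "complete_bipartite_digraph s t (with_proj K)"
    unfolding complete_bipartite_digraph_pair_def
    using \<open>finite (X \<union> T)\<close> \<open>X \<inter> T = {}\<close> assms(4,5) by (auto simp: K_def)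
  then interpret K: pair_graph K by (rule pair_graphI_complete_bipartite)
  have "subgraph (with_proj K) (with_proj G)"
    using verts XT TX K.wf_digraph_axioms wf_digraph_axioms
    by (auto simp: subgraph_def compatible_def K_def)
  moreover have "properly_coloured (edges_of (parcs K)) col"
    unfolding properly_coloured_def
  proof (intro ballI impI)
    fix e f assume "e \<in> edges_of (parcs K)" "f \<in> edges_of (parcs K)" and ef: "e \<noteq> f \<and> e \<inter> f \<noteq> {}"
    moreover have "edges_of (parcs K) = (\<lambda>(x, v). {v, x}) ` (X \<times> T)"
      by (force simp: edges_of_def K_def insert_commute)
    ultimately obtain x v x' v' where e: "x \<in> X" "v \<in> T" "e = {v, x}" and f: "x' \<in> X" "v' \<in> T" "f = {v', x'}"
      by auto
    have "x = x' \<or> v = v'" using ef e f \<open>X \<inter> T = {}\<close> by auto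
    then show "col e \<noteq> col f"
      using rb ef e f by (auto simp: rainbow_biclique_def dest: inj_onD)
  qed
  ultimately show ?thesis using bip by (auto simp: has_properly_coloured_complete_bipartite_def)
qed

text \<open>Here \<open>y ^ s\<close> equals
  \<open>(t - 1) * (s ^ s / (s - 1)!) * n ^ (s - 1)\<close>, and \<open>s! \<le> s ^ s\<close> gives
  \<open>s \<le> s ^ s / (s - 1)!\<close>.\<close>

lemma biclique_bound_le_power:
  fixes n s t :: nat
  assumes "1 \<le> s" and "2 \<le> t" and "0 < n"
  defines "y \<equiv> ((real t - 1) / fact (s - 1)) powr (1 / real s) * real s * real n powr (1 - 1 / real s)"
  shows "real (t - 1) * real s * real n ^ (s - 1) \<le> y ^ s"
proof -
  have root: "(x powr (1 / real s)) ^ s = x" if "0 < x" for x :: real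
    using that \<open>1 \<le> s\<close> by (simp add: powr_powr flip: powr_realpow)
  have "(1 - 1 / real s) * real s = real (s - 1)"
    using \<open>1 \<le> s\<close> by (simp add: left_diff_distrib of_nat_diff)
  then have "(real n powr (1 - 1 / real s)) ^ s = real n powr (real (s - 1))"
    using \<open>0 < n\<close> by (simp add: powr_powr flip: powr_realpow)
  then have "(real n powr (1 - 1 / real s)) ^ s = real n ^ (s - 1)"
    using \<open>0 < n\<close> by (simp add: powr_realpow)
  then have y: "y ^ s = real (t - 1) * (real s ^ s / fact (s - 1)) * real n ^ (s - 1)"
    using root[of "(real t - 1) / fact (s - 1)"] \<open>2 \<le> t\<close>
    by (simp add: y_def power_mult_distrib of_nat_diff)
  have "fact s = real s * fact (s - 1)" using \<open>1 \<le> s\<close> by (simp add: fact_reduce)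
  moreover have "(fact s :: real) \<le> real s ^ s" using fact_le_power[of s] by simp
  ultimately have "real s \<le> real s ^ s / fact (s - 1)" by (simp add: pos_le_divide_eq)
  then show ?thesis unfolding y by (intro mult_right_mono mult_left_mono) auto
qed

theorem theorem1p3:
  fixes n s t :: nat and G :: "'a pair_pre_digraph" and col :: "'a set \<Rightarrow> 'c"
  assumes "2 \<le> s" and "s \<le> t" and "t < n"
    and "pair_graph G" and "card (pverts G) = n"
    and "\<not> has_properly_coloured_complete_bipartite s t G col"
  shows "\<exists>H D :: 'a pair_pre_digraph.
    pair_graph H \<and> spanning (with_proj H) (with_proj G) \<and> orientation_of D H \<and>
    (\<forall>v \<in> pverts G.
      real (out_degree (with_proj D) v) >
        real (colour_degree G col v)
        - ((real t - 1) / fact (s - 1)) powr (1 / real s) * real s * real n powr (1 - 1 / real s)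
        - real s) \<and>
    (\<forall>p. pre_digraph.cycle (with_proj D) p \<longrightarrow> properly_coloured_cycle H col p)"
proof -
  interpret G: pair_graph G by fact
  interpret simple_graph "pverts G" "parcs G"
    using G.pair_finite_verts G.in_arcsD1 G.in_arcsD2 G.arcs_symmetric
    by unfold_locales (auto dest: G.no_loops')
  define y where "y = ((real t - 1) / fact (s - 1)) powr (1 / real s) * real s * real n powr (1 - 1 / real s)"
  obtain P where "star_forest (pverts G) P col" and P_G: "P \<union> P\<inverse> \<subseteq> parcs G"
    and colours: "\<And>v. (\<lambda>w. col {v, w}) ` ((P \<union> P\<inverse>) `` {v}) = (\<lambda>w. col {v, w}) ` (parcs G `` {v})"
    using exists_star_forest[of col] by auto
  then interpret star_forest "pverts G" P col by simp
  have "0 \<le> y" by (simp add: y_def)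
  have bound: "real (t - 1) * real s * real (card (pverts G)) ^ (s - 1) \<le> y ^ s"
    unfolding y_def \<open>card (pverts G) = n\<close> using assms by (intro biclique_bound_le_power) auto
  \<comment> \<open>A rainbow biclique among the chosen edges is one in \<open>G\<close>;
    \<open>2 \<le> s\<close> and \<open>s \<le> t\<close> make both sides nonempty.\<close>
  have no_biclique: "card T \<noteq> t" if "rainbow_biclique (P \<union> P\<inverse>) col X T" "card X = s" for X T
    using has_properly_coloured_complete_bipartite_if_rainbow_biclique[OF \<open>pair_graph G\<close> that(1) P_G that(2)]
      assms that(2) by fastforce
  have "\<exists>I. \<forall>v\<in>pverts G. real (loss I v) < y + real s"
    by (rule exists_orientation_loss_less[OF _ \<open>0 \<le> y\<close> bound]) (use no_biclique \<open>2 \<le> s\<close> in auto)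
  then obtain I where I: "\<And>v. v \<in> pverts G \<Longrightarrow> real (loss I v) < y + real s" by auto
  define H where "H = \<lparr>pverts = pverts G, parcs = P \<union> P\<inverse>\<rparr>"
  define D where "D = \<lparr>pverts = pverts G, parcs = orient I\<rparr>"
  have H: "pair_graph H"
  proof -
    have "(v, v) \<notin> P" for v using P_asym by blast
    then show ?thesis
      using P_subset finite_V finite_P
      by unfold_locales (auto simp: H_def symmetric_def intro: symI)
  qed
  interpret H: pair_graph H by fact
  have "spanning (with_proj H) (with_proj G)"
    using P_G H.wf_digraph_axioms G.wf_digraph_axioms
    by (auto simp: spanning_def subgraph_def compatible_def H_def)
  moreover have "orientation_of D H"
    using orient_Un_converse orient_Int_converse by (simp add: orientation_of_def H_def D_def)
  moreover have "real (out_degree (with_proj D) v) > real (colour_degree G col v) - y - real s"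
    if "v \<in> pverts G" for v
  proof -
    have "out_arcs (with_proj D) v = Pair v ` (orient I `` {v})"
      by (auto simp: out_arcs_def D_def)
    then have "out_degree (with_proj D) v = card (orient I `` {v})"
      by (simp add: out_degree_def card_image inj_on_def)
    moreover have "colour_degree G col v = card ((\<lambda>w. col {v, w}) ` (parcs G `` {v}))"
      unfolding colour_degree_def by (rule arg_cong[where f = card]) auto
    \<comment> \<open>By \<open>colours\<close> every colour degree survives the passage to
      \<open>H\<close>, so only the loss is subtracted.\<close>
    ultimately show ?thesis
      using colour_degree_le[of v I] I[OF that] by (simp add: colours)
  qed
  moreover have "properly_coloured_cycle H col p" if "pre_digraph.cycle (with_proj D) p" for p
    using that orient_subset orient_Int_converse orient_path_colours
    by (intro directed_cycle_properly_coloured[of D H]) (auto simp: D_def H_def)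
  ultimately show ?thesis using H unfolding y_def by blast
qed

end
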